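(* Let $h_1,l_1,l_2,\alpha_1,\lambda\in\mathbb{C}$ and $t_1,t_2\in\mathbb{C}\setminus\{0\}$. Consider the $q$-difference equation (variant of the confluent $q$-hypergeometric equation of type $(2,1)$) $$(x-q^{l_1-1/2}t_1)(x-q^{l_2-1/2}t_2)g(qx)-q^{-h_1+l_1+l_2+2\lambda-1/2}t_2(x-q^{h_1+1/2}t_1)g(x/q)$$ $$-\big[q^{-\alpha_1}x^2-q^{l_1+l_2+\lambda-1/2}\{q^{-l_2}t_1+(q^{-h_1}+q^{-l_1})t_2\}x+q^{l_1+l_2+\lambda}(1+q^{-1})t_1t_2\big]g(x)=0.$$ (i) Let $(i,i')=(1,2)$ or $(2,1)$. Then $$x^\lambda\sum_{n=0}^\infty(q^{-\lambda-\alpha_1+h_1-l_{i'}+1}t_1/t_{i'})^n\frac{(q^{\lambda+\alpha_1};q)_n}{(q^{h_1-l_i+1}t_1/t_i;q)_n(q;q)_n}\Big(\frac{x}{q^{l_i-1/2}t_i};q\Big)_n$$ $$\Big(=x^\lambda\,{}_2\phi_1\Big(q^{\lambda+\alpha_1},\frac{x}{q^{l_i-1/2}t_i};q^{h_1-l_i+1}t_1/t_i;q,q^{-\lambda-\alpha_1+h_1-l_{i'}+1}t_1/t_{i'}\Big)\Big)$$ is a formal solution of this equation. (ii) The function $$g(x)=x^{-\alpha_1}\sum_{n=0}^\infty(q^{1/2}x^{-1})^n(q^{\lambda+\alpha_1};q)_n\sum_{k=0}^n\frac{(q^{\lambda+\alpha_1-h_1+l_1};q)_{n-k}}{(q;q)_k(q;q)_{n-k}}(q^{l_1}t_1)^k(q^{l_2}t_2)^{n-k}$$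 is a formal solution of this equation. (iii) The function $$g(x)=x^{-\alpha_1}\sum_{n=0}^\infty(q^{h_1+1/2}t_1/x;q)_n\frac{(q^{\lambda+\alpha_1};q)_n}{(q^{h_1-l_2+1}t_1/t_2;q)_n}q^n\sum_{k=0}^n\frac{q^{k(k+1)/2}(-q^{h_1-l_2}t_1/t_2)^k}{(q^{h_1-l_1+1};q)_k(q;q)_k(q;q)_{n-k}}$$ is a formal solution of this equation.
   Context: Conventions: $q\in\mathbb{C}\setminus\{0\}$ is not a root of unity, with a fixed choice of $\log q$, and $q^{a}=\exp(a\log q)$. $(\lambda;q)_n=\prod_{j=0}^{n-1}(1-\lambda q^j)$. The basic hypergeometric series is ${}_r\phi_s(a_1,\dots,a_r;b_1,\dots,b_s;q,z)=\sum_{n\ge0}\frac{(a_1;q)_n\cdots(a_r;q)_n}{(b_1;q)_n\cdots(b_s;q)_n(q;q)_n}\big[(-1)^nq^{n(n-1)/2}\big]^{1+s-r}z^n$. Parameters are assumed such that no denominator factor in the displayed series vanishes. Formal solutions: convergence is not considered. For $\mu\in\mathbb{C}$, $x^\mu$ is a symbol with $(q^{\pm1}x)^\mu=q^{\pm\mu}x^\mu$. Each series has the form $x^\mu\sum_{n\ge0}a_n\varphi_n(x)$, where $a_n$ does not depend on $x$ and $\varphi_n$ (the $x$-dependent part of the $n$-th term) is a polynomial of degree $n$ in $x$ or a polynomial of degree $n$ in $1/x$ (here $\varphi_n=(x/(q^{l_i-1/2}t_i);q)_n$ in (i), $x^{-n}$ in (ii), $(q^{h_1+1/2}t_1/x;q)_n$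 in (iii)). It is a formal solution if, substituting termwise into the left-hand side, dividing by $x^\mu$ (and also by $x^2$ when the $\varphi_n$ are polynomials in $1/x$), and expanding each resulting term in the basis $(\varphi_m)_{m\ge0}$ (in the $1/x$ case, the basis of polynomials in $1/x$), the total coefficient of every $\varphi_m$ (a finite sum) is zero. If the series terminates this means it is an exact solution. *)

theory Defs
  imports "HOL-Analysis.Analysis"
begin

text \<open>The argument \<open>lq\<close> is the chosen value of $\log q$, so \<open>qpow lq a\<close> is $q^a$.\<close>

definition qpow :: "complex \<Rightarrow> complex \<Rightarrow> complex" where
  "qpow lq a = exp (a * lq)"

definition qpoch :: "complex \<Rightarrow> complex \<Rightarrow> nat \<Rightarrow> complex" where
  "qpoch a q n = (\<Prod>j<n. 1 - a * q ^ j)"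

text \<open>The \<open>n\<close>-th term of the basic hypergeometric series with numerator parameters \<open>us\<close>
  (the list of the $a_i$) and denominator parameters \<open>vs\<close> (the list of the $b_i$).\<close>

definition bhs_term ::
    "complex list \<Rightarrow> complex list \<Rightarrow> complex \<Rightarrow> complex \<Rightarrow> nat \<Rightarrow> complex" where
  "bhs_term us vs q z n =
     (\<Prod>a\<leftarrow>us. qpoch a q n) / ((\<Prod>b\<leftarrow>vs. qpoch b q n) * qpoch q q n)
     * ((-1) ^ n * q ^ (n * (n - 1) div 2)) powi (1 + int (length vs) - int (length us))
     * z ^ n"

text \<open>Left-hand side of the variant of the confluent $q$-hypergeometric equation of type
  $(2,1)$ at the point \<open>x\<close>, with \<open>gq\<close>, \<open>gp\<close>, \<open>g0\<close> standing for the values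
  $g(qx)$, $g(x/q)$, $g(x)$. Only \<open>l 1\<close>, \<open>l 2\<close>, \<open>t 1\<close>, \<open>t 2\<close> are used.\<close>

definition confluent_lhs ::
    "complex \<Rightarrow> complex \<Rightarrow> complex \<Rightarrow> (nat \<Rightarrow> complex) \<Rightarrow> complex \<Rightarrow> complex \<Rightarrow> (nat \<Rightarrow> complex)
     \<Rightarrow> complex \<Rightarrow> complex \<Rightarrow> complex \<Rightarrow> complex \<Rightarrow> complex" where
  "confluent_lhs q lq h1 l \<alpha>1 lam t x gq gp g0 =
     (x - qpow lq (l 1 - 1/2) * t 1) * (x - qpow lq (l 2 - 1/2) * t 2) * gq
     - qpow lq (- h1 + l 1 + l 2 + 2 * lam - 1/2) * t 2 * (x - qpow lq (h1 + 1/2) * t 1) * gp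
     - (qpow lq (- \<alpha>1) * x\<^sup>2
        - qpow lq (l 1 + l 2 + lam - 1/2)
            * (qpow lq (- l 2) * t 1 + (qpow lq (- h1) + qpow lq (- l 1)) * t 2) * x
        + qpow lq (l 1 + l 2 + lam) * (1 + inverse q) * t 1 * t 2) * g0"

text \<open>\<open>E x gq gp g0\<close> is the left-hand side of a linear $q$-difference equation, in the
  sense above. Substituting $g(x) = x^\mu f(x)$, with $(q^{\pm1}x)^\mu = q^{\pm\mu}x^\mu$, and
  dividing by the symbol $x^\mu$ gives the following function of \<open>x\<close>.\<close>

definition subst_term ::
    "complex \<Rightarrow> complex \<Rightarrow> (complex \<Rightarrow> complex \<Rightarrow> complex \<Rightarrow> complex \<Rightarrow> complex) \<Rightarrow> complex
     \<Rightarrow> (complex \<Rightarrow> complex) \<Rightarrow> complex \<Rightarrow> complex" where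
  "subst_term q lq E \<mu> f x = E x (qpow lq \<mu> * f (q * x)) (qpow lq (- \<mu>) * f (x / q)) (f x)"

text \<open>Each \<open>u n\<close> is a finite combination of the \<open>\<phi> m\<close>, \<open>c n m\<close> being the coefficient of
  \<open>\<phi> m\<close> in \<open>u n\<close>; for every \<open>m\<close> only finitely many \<open>n\<close> contribute, and the total
  coefficient of \<open>\<phi> m\<close> is zero. The coefficients \<open>c\<close> are unique when the \<open>\<phi> m\<close> are
  linearly independent on the nonzero complex numbers, as is the case in both uses below.\<close>

definition coefficients_cancel ::
    "(nat \<Rightarrow> complex \<Rightarrow> complex) \<Rightarrow> (nat \<Rightarrow> complex \<Rightarrow> complex) \<Rightarrow> bool" where
  "coefficients_cancel \<phi> u \<longleftrightarrow>
     (\<exists>c :: nat \<Rightarrow> nat \<Rightarrow> complex.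
        (\<forall>n. finite {m. c n m \<noteq> 0} \<and>
             (\<forall>x. x \<noteq> 0 \<longrightarrow> u n x = (\<Sum>m | c n m \<noteq> 0. c n m * \<phi> m x))) \<and>
        (\<forall>m. finite {n. c n m \<noteq> 0} \<and> (\<Sum>n | c n m \<noteq> 0. c n m) = 0))"

definition is_poly_of_degree :: "nat \<Rightarrow> (complex \<Rightarrow> complex) \<Rightarrow> bool" where
  "is_poly_of_degree n f \<longleftrightarrow>
     (\<exists>b :: nat \<Rightarrow> complex. b n \<noteq> 0 \<and> (\<forall>y. y \<noteq> 0 \<longrightarrow> f y = (\<Sum>k\<le>n. b k * y ^ k)))"

text \<open>The series $x^\mu\sum_n a_n\varphi_n(x)$ is a formal solution of \<open>E = 0\<close>: first with
  $\varphi_n$ a polynomial of degree $n$ in $x$, then with $\varphi_n$ a polynomial of degree $n$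
  in $1/x$, where one also divides by $x^2$.\<close>

definition formal_solution ::
    "complex \<Rightarrow> complex \<Rightarrow> (complex \<Rightarrow> complex \<Rightarrow> complex \<Rightarrow> complex \<Rightarrow> complex) \<Rightarrow> complex
     \<Rightarrow> (nat \<Rightarrow> complex) \<Rightarrow> (nat \<Rightarrow> complex \<Rightarrow> complex) \<Rightarrow> bool" where
  "formal_solution q lq E \<mu> a \<phi> \<longleftrightarrow>
     (\<forall>n. is_poly_of_degree n (\<phi> n)) \<and>
     coefficients_cancel \<phi> (\<lambda>n. subst_term q lq E \<mu> (\<lambda>y. a n * \<phi> n y))"

definition formal_solution_inv ::
    "complex \<Rightarrow> complex \<Rightarrow> (complex \<Rightarrow> complex \<Rightarrow> complex \<Rightarrow> complex \<Rightarrow> complex) \<Rightarrow> complex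
     \<Rightarrow> (nat \<Rightarrow> complex) \<Rightarrow> (nat \<Rightarrow> complex \<Rightarrow> complex) \<Rightarrow> bool" where
  "formal_solution_inv q lq E \<mu> a \<phi> \<longleftrightarrow>
     (\<forall>n. is_poly_of_degree n (\<lambda>y. \<phi> n (1 / y))) \<and>
     coefficients_cancel \<phi> (\<lambda>n x. subst_term q lq E \<mu> (\<lambda>y. a n * \<phi> n y) x / x\<^sup>2)"

end

theory Submission
  imports Defs
begin

text \<open>With \<open>A = q\<^bsup>l1 - 1/2\<^esup> t1\<close>, \<open>B = q\<^bsup>l2 - 1/2\<^esup> t2\<close>, \<open>C = q\<^bsup>h1 + 1/2\<^esup> t1\<close>, \<open>L = q\<^bsup>\<lambda>\<^esup>\<close>,
  \<open>M = q\<^bsup>- \<alpha>1\<^esup>\<close> the equation is rational in \<open>A, B, C, L, M, q\<close> and symmetric in \<open>A\<close> and \<open>B\<close>, so that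
  one index suffices in (i). In each case the equation sends \<open>\<phi>\<^sub>n\<close> to a combination of
  \<open>\<phi>\<^sub>n\<^sub>-\<^sub>1, \<dots>, \<phi>\<^sub>n\<^sub>+\<^sub>2\<close>, and the resulting four-term condition on the coefficients is a combination
  of shifts of a shorter recurrence: the first-order hypergeometric one in (i), and in (ii) and (iii)
  a three-term recurrence for the inner sum, read off from the \<open>q\<close>-difference equation of its
  generating function.\<close>

unbundle no vec_syntax
unbundle fps_syntax

section \<open>Powers of \<open>q\<close>, and \<open>q\<close>-shifted factorials as a polynomial
  basis\<close>

lemma qpow_add: "qpow lq (x + y) = qpow lq x * qpow lq y"
  by (simp add: qpow_def ring_distribs exp_add)

lemma qpow_minus: "qpow lq (- x) = inverse (qpow lq x)"
  by (simp add: qpow_def exp_minus)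

lemma qpow_diff: "qpow lq (x - y) = qpow lq x / qpow lq y"
  by (simp add: qpow_def ring_distribs exp_diff)

lemma qpow_double: "qpow lq (2 * x) = (qpow lq x)\<^sup>2"
  using qpow_add[of lq x x] by (simp add: power2_eq_square)

lemma qpow_nonzero [simp]: "qpow lq x \<noteq> 0"
  by (simp add: qpow_def)

lemma qpow_half: "qpow lq (1/2) * qpow lq (1/2) = exp lq"
  using qpow_add[of lq "1/2" "1/2"] by (simp add: qpow_def)

lemma qpoch_0 [simp]: "qpoch a q 0 = 1"
  by (simp add: qpoch_def)

lemma qpoch_Suc: "qpoch a q (Suc n) = qpoch a q n * (1 - a * q ^ n)"
  by (simp add: qpoch_def)

lemma qpoch_scaled_arg: "qpoch (q * y) q n * (1 - y) = qpoch y q (Suc n)"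
  by (simp only: qpoch_def prod.lessThan_Suc_shift) (simp add: mult_ac)

lemma mult_qpoch:
  assumes "q \<noteq> 0"
  shows "y * qpoch y q n = (qpoch y q n - qpoch y q (Suc n)) / q ^ n"
  using assms by (simp add: qpoch_Suc field_simps)

text \<open>For \<open>n > 0\<close> the left side is
  \<open>(1 - y / q) * qpoch y q (n - 1)\<close>, and with \<open>p = 1 / q ^ n\<close> one has
  \<open>1 - y / q = p * (1 - y * q ^ (n - 1)) + (1 - p)\<close>. For \<open>n = 0\<close> the
  coefficient \<open>1 - p\<close> vanishes, so the truncated index \<open>n - 1\<close> does no
  harm.\<close>

lemma qpoch_div_arg:
  assumes "q \<noteq> 0"
  shows "qpoch (y / q) q n = qpoch y q n / q ^ n + (1 - 1 / q ^ n) * qpoch y q (n - 1)"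
proof (cases n)
  case (Suc m)
  have *: "qpoch (y / q) q n = qpoch y q m * (1 - y / q)"
    using qpoch_scaled_arg[of q "y / q" m] assms by (simp add: Suc)
  show ?thesis
    unfolding * using assms by (simp add: Suc qpoch_Suc field_simps)
qed simp

lemma is_poly_of_degree_qpoch:
  assumes "q \<noteq> 0" "d \<noteq> 0"
  shows "is_poly_of_degree n (\<lambda>y. qpoch (d * y) q n)"
proof (induction n)
  case 0
  show ?case
    unfolding is_poly_of_degree_def by (intro exI[of _ "\<lambda>_. 1"]) simp
next
  case (Suc n)
  then obtain b where b: "b n \<noteq> 0"
      "\<And>y. y \<noteq> 0 \<Longrightarrow> qpoch (d * y) q n = (\<Sum>k\<le>n. b k * y ^ k)"
    unfolding is_poly_of_degree_def by blast
  define e where "e = d * q ^ n"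
  \<comment> \<open>These are the coefficients after multiplication by the new factor
    \<open>1 - e * y\<close>; the leading one is \<open>- e * b n\<close>.\<close>
  define b' where "b' k = (if k \<le> n then b k else 0) - (if k = 0 then 0 else e * b (k - 1))" for k
  have "qpoch (d * y) q (Suc n) = (\<Sum>k\<le>Suc n. b' k * y ^ k)" if "y \<noteq> 0" for y
  proof -
    have "(\<Sum>k\<le>Suc n. b' k * y ^ k)
        = (\<Sum>k\<le>Suc n. (if k \<le> n then b k else 0) * y ^ k)
          - (\<Sum>k\<le>Suc n. (if k = 0 then 0 else e * b (k - 1)) * y ^ k)"
      by (simp only: b'_def left_diff_distrib sum_subtractf)
    also have "(\<Sum>k\<le>Suc n. (if k \<le> n then b k else 0) * y ^ k) = (\<Sum>k\<le>n. b k * y ^ k)"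
      by simp
    also have "(\<Sum>k\<le>Suc n. (if k = 0 then 0 else e * b (k - 1)) * y ^ k)
        = e * y * (\<Sum>k\<le>n. b k * y ^ k)"
      by (simp only: sum.atMost_Suc_shift) (simp add: sum_distrib_left mult_ac)
    finally show ?thesis
      using b(2)[OF that] by (simp add: qpoch_Suc e_def algebra_simps)
  qed
  moreover have "b' (Suc n) \<noteq> 0"
    using b assms by (simp add: b'_def e_def)
  ultimately show ?case
    unfolding is_poly_of_degree_def by blast
qed

section \<open>Cancellation through a banded coefficient matrix\<close>

text \<open>Column \<open>m\<close> of the coefficient matrix has at most four entries: columns 0
  and 1 are cut short, and the last hypothesis is column \<open>k + 2\<close>. As
  \<open>n - 1\<close> is 0 for \<open>n = 0\<close>, the condition \<open>e0 0 = 0\<close> removes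
  a spurious contribution to column 0.\<close>

lemma coefficients_cancel_banded:
  fixes e0 e1 e2 e3 :: "nat \<Rightarrow> complex"
  assumes u: "\<And>n x. x \<noteq> 0 \<Longrightarrow>
      u n x = e0 n * \<phi> (n - 1) x + e1 n * \<phi> n x + e2 n * \<phi> (n + 1) x + e3 n * \<phi> (n + 2) x"
    and "e0 0 = 0"
    and "e0 1 + e1 0 = 0"
    and "e0 2 + e1 1 + e2 0 = 0"
    and "\<And>k. e0 (k + 3) + e1 (k + 2) + e2 (k + 1) + e3 k = 0"
  shows "coefficients_cancel \<phi> u"
proof -
  define c where "c n m = (if m = n + 2 then e3 n else if m = n + 1 then e2 n
      else if m = n then e1 n else if Suc m = n then e0 n else 0)" for n m
  have row: "{m. c n m \<noteq> 0} \<subseteq> {n - 1..n + 2}" for n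
    by (auto simp: c_def split: if_splits)
  have col: "{n. c n m \<noteq> 0} \<subseteq> {m - 2..m + 1}" for m
    by (auto simp: c_def split: if_splits)
  have "u n x = (\<Sum>m | c n m \<noteq> 0. c n m * \<phi> m x)" if "x \<noteq> 0" for n x
  proof -
    have "(\<Sum>m | c n m \<noteq> 0. c n m * \<phi> m x) = (\<Sum>m\<in>{n - 1..n + 2}. c n m * \<phi> m x)"
      using row by (intro sum.mono_neutral_left) auto
    also have "\<dots> = u n x"
    proof (cases n)
      case 0
      have "{0..2::nat} = {0, 1, 2}" by auto
      then show ?thesis using assms(2) u[OF that, of n] 0 by (simp add: c_def)
    next
      case (Suc k)
      have "{k..k + 3} = {k, k + 1, k + 2, k + 3}" by auto
      then show ?thesis
        using u[OF that, of n] Suc by (simp add: c_def eval_nat_numeral)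
    qed
    finally show ?thesis by simp
  qed
  moreover have "(\<Sum>n | c n m \<noteq> 0. c n m) = 0" for m
  proof -
    have "(\<Sum>n | c n m \<noteq> 0. c n m) = (\<Sum>n\<in>{m - 2..m + 1}. c n m)"
      using col by (intro sum.mono_neutral_left) auto
    also have "\<dots> = 0"
    proof -
      consider "m = 0" | "m = 1" | k where "m = k + 2"
        by (metis One_nat_def add_2_eq_Suc' not0_implies_Suc)
      then show ?thesis
      proof cases
        case 1
        have "{0..1::nat} = {0, 1}" by auto
        then show ?thesis using 1 assms(3) by (simp add: c_def add.commute)
      next
        case 2
        have "{0..2::nat} = {0, 1, 2}" by auto
        then show ?thesis using 2 assms(4) by (simp add: c_def add_ac numeral_2_eq_2)
      next
        case 3
        have "{k..k + 3} = {k, k + 1, k + 2, k + 3}" by auto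
        then show ?thesis
          using 3 assms(5)[of k] by (simp add: c_def add_ac eval_nat_numeral)
      qed
    qed
    finally show ?thesis .
  qed
  ultimately show ?thesis
    unfolding coefficients_cancel_def
    using finite_subset[OF row] finite_subset[OF col] by (intro exI[of _ c]) simp
qed

text \<open>These rules express the shift and multiplication by \<open>y\<close> in the basis,
  moving the index by at most one. The last one keeps the factor \<open>1 - p\<close>, which is zero
  for \<open>n = 0\<close>, so that it also covers the truncated \<open>n - 1\<close>.\<close>

lemma qpoch_expansions:
  fixes q y :: complex and n :: nat
  assumes "q \<noteq> 0"
  defines "p \<equiv> 1 / q ^ n"
  defines "f \<equiv> \<lambda>m. qpoch y q m"
  shows "qpoch (y / q) q n = p * f n + (1 - p) * f (n - 1)"
    and "y * f n = p * (f n - f (n + 1))"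
    and "y * f (n + 1) = p / q * (f (n + 1) - f (n + 2))"
    and "y * ((1 - p) * f (n - 1)) = q * p * ((1 - p) * f (n - 1) - (1 - p) * f n)"
proof -
  show "qpoch (y / q) q n = p * f n + (1 - p) * f (n - 1)"
    using qpoch_div_arg[OF assms(1)] by (simp add: p_def f_def)
  show "y * f n = p * (f n - f (n + 1))" "y * f (n + 1) = p / q * (f (n + 1) - f (n + 2))"
    using mult_qpoch[OF assms(1), of y n] mult_qpoch[OF assms(1), of y "Suc n"]
    by (simp_all add: p_def f_def field_simps)
  show "y * ((1 - p) * f (n - 1)) = q * p * ((1 - p) * f (n - 1) - (1 - p) * f n)"
  proof (cases n)
    case 0
    then show ?thesis by (simp add: p_def)
  next
    case (Suc m)
    have "q * p = 1 / q ^ m"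
      using assms(1) by (simp add: p_def Suc)
    then have "y * f m = q * p * (f m - f n)"
      using mult_qpoch[OF assms(1), of y m] by (simp add: f_def Suc)
    then have "y * ((1 - p) * f m) = (1 - p) * (q * p * (f m - f n))"
      by simp
    also have "\<dots> = q * p * ((1 - p) * f m - (1 - p) * f n)"
      by (simp add: algebra_simps)
    finally show ?thesis
      by (simp add: Suc)
  qed
qed

section \<open>Generating functions and recurrences of the inner sums\<close>

text \<open>\<open>c\<close> is the Cauchy product of \<open>U\<close> and \<open>V\<close>, which
  by the q-binomial theorem stand for \<open>1 / (\<alpha> w; q)_\<infinity>\<close> and
  \<open>(s \<beta> w; q)_\<infinity> / (\<beta> w; q)_\<infinity>\<close>. Each satisfies a
  first-order q-difference equation, hence so does the product. The formula for \<open>c 1\<close>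
  is the recurrence at \<open>n = -1\<close>, with \<open>c (-1) = 0\<close> and
  \<open>c 0 = 1\<close>.\<close>

lemma qbinomial_convolution_recurrence:
  fixes q s \<alpha> \<beta> :: complex
  assumes "\<And>n. qpoch q q n \<noteq> 0"
  defines "c \<equiv> \<lambda>n. \<Sum>k\<le>n. qpoch s q (n - k) / (qpoch q q k * qpoch q q (n - k))
    * \<alpha> ^ k * \<beta> ^ (n - k)"
  shows "(1 - q) * c 1 = \<alpha> + \<beta> - s * \<beta>"
    and "(1 - q ^ (n + 2)) * c (n + 2)
      = (\<alpha> + \<beta> - s * \<beta> * q ^ (n + 1)) * c (n + 1) - \<alpha> * \<beta> * c n"
proof -
  define U where "U = Abs_fps (\<lambda>n. \<alpha> ^ n / qpoch q q n)"
  define V where "V = Abs_fps (\<lambda>n. qpoch s q n / qpoch q q n * \<beta> ^ n)"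
  \<comment> \<open>\<open>\<sigma>\<close> substitutes \<open>q w\<close> for the variable
    \<open>w\<close>; being multiplicative, it lets the equations of the two factors be
    combined.\<close>
  define \<sigma> where "\<sigma> F = F oo (fps_const q * fps_X)" for F :: "complex fps"
  have \<sigma>: "\<sigma> F $ n = q ^ n * F $ n" for F n
    by (simp add: \<sigma>_def fps_compose_linear)
  have c: "c n = (U * V) $ n" for n
    by (simp add: c_def U_def V_def fps_mult_nth atLeast0AtMost mult_ac)
  have step: "1 - q * q ^ n \<noteq> 0" "qpoch q q n \<noteq> 0" for n
    using assms(1)[of "Suc n"] by (auto simp: qpoch_Suc)
  have U: "\<sigma> U = (1 - fps_const \<alpha> * fps_X) * U"
  proof (rule fps_ext)
    show "\<sigma> U $ n = ((1 - fps_const \<alpha> * fps_X) * U) $ n" for n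
      using step by (cases n) (simp_all add: \<sigma> U_def left_diff_distrib mult.assoc qpoch_Suc field_simps)
  qed
  have V: "(1 - fps_const (s * \<beta>) * fps_X) * \<sigma> V = (1 - fps_const \<beta> * fps_X) * V"
  proof (rule fps_ext)
    show "((1 - fps_const (s * \<beta>) * fps_X) * \<sigma> V) $ n = ((1 - fps_const \<beta> * fps_X) * V) $ n" for n
      using step
      by (cases n) (simp_all add: \<sigma> V_def left_diff_distrib mult.assoc qpoch_Suc field_simps)
  qed
  have "(1 - fps_const (s * \<beta>) * fps_X) * \<sigma> (U * V)
      = (1 - fps_const \<alpha> * fps_X) * (1 - fps_const \<beta> * fps_X) * (U * V)"
    using U V by (simp add: \<sigma>_def fps_compose_mult_distrib mult_ac)
  then have eq: "\<sigma> (U * V) - fps_const (s * \<beta>) * (fps_X * \<sigma> (U * V))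
      = U * V - fps_const (\<alpha> + \<beta>) * (fps_X * (U * V))
        + fps_const (\<alpha> * \<beta>) * (fps_X * (fps_X * (U * V)))"
    by (simp add: algebra_simps flip: fps_const_add fps_const_mult)
  have c0: "(U * V) $ 0 = 1"
    by (simp add: U_def V_def)
  show "(1 - q) * c 1 = \<alpha> + \<beta> - s * \<beta>"
    using arg_cong[OF eq, of "\<lambda>F. F $ 1"] c0 by (simp add: c \<sigma> algebra_simps)
  show "(1 - q ^ (n + 2)) * c (n + 2)
      = (\<alpha> + \<beta> - s * \<beta> * q ^ (n + 1)) * c (n + 1) - \<alpha> * \<beta> * c n"
    using arg_cong[OF eq, of "\<lambda>F. F $ (n + 2)"]
    by (simp add: c \<sigma> eval_nat_numeral) (simp add: algebra_simps)
qed

text \<open>The sums below are the coefficients of \<open>E(w) / (w; q)\<^sub>\<infinity>\<close>, where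
  \<open>E\<close> satisfies a second-order \<open>q\<close>-difference equation and \<open>(q w; q)\<^sub>\<infinity> (1 - w) = (w; q)\<^sub>\<infinity>\<close>.\<close>

lemma qexp_convolution_recurrence:
  fixes q \<gamma> \<delta> :: complex
  assumes "q \<noteq> 0" "\<And>n. qpoch q q n \<noteq> 0" "\<And>n. qpoch \<gamma> q n \<noteq> 0"
  defines "S \<equiv> \<lambda>n. \<Sum>k\<le>n. q ^ (k * (k + 1) div 2) * (- (\<delta> / q)) ^ k
    / (qpoch \<gamma> q k * qpoch q q k * qpoch q q (n - k))"
  shows "(1 - q) * (1 - \<gamma>) * S 1 = 1 - \<gamma> - \<delta>"
    and "(1 - q ^ (n + 2)) * (1 - \<gamma> * q ^ (n + 1)) * S (n + 2)
      = (1 + q - (\<delta> + q + \<gamma>) * q ^ (n + 1)) * S (n + 1) - q * (1 - \<delta> * q ^ n) * S n"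
proof -
  \<comment> \<open>Since \<open>q ^ (k * (k + 1) div 2) * (- (\<delta> / q)) ^ k\<close> is
    \<open>(-1)^k q^(k(k-1)/2) \<delta>^k\<close>, the series \<open>E\<close> is 1phi1 with
    parameters \<open>0; \<gamma>\<close> and argument \<open>\<delta> w\<close>.\<close>
  define e where "e k = q ^ (k * (k + 1) div 2) * (- (\<delta> / q)) ^ k / (qpoch \<gamma> q k * qpoch q q k)" for k
  define E where "E = Abs_fps e"
  define G where "G = Abs_fps (\<lambda>n. 1 / qpoch q q n)"
  define \<sigma> where "\<sigma> F = F oo (fps_const q * fps_X)" for F :: "complex fps"
  have \<sigma>: "\<sigma> F $ n = q ^ n * F $ n" for F n
    by (simp add: \<sigma>_def fps_compose_linear)
  have \<sigma>_mult: "\<sigma> (F * H) = \<sigma> F * \<sigma> H" for F H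
    by (simp add: \<sigma>_def fps_compose_mult_distrib)
  have S: "S n = (E * G) $ n" for n
    by (simp add: S_def E_def e_def G_def fps_mult_nth atLeast0AtMost)
  have step: "1 - q * q ^ n \<noteq> 0" "1 - \<gamma> * q ^ n \<noteq> 0" "qpoch q q n \<noteq> 0" for n
    using assms(2,3)[of "Suc n"] by (auto simp: qpoch_Suc)
  have G: "\<sigma> G = (1 - fps_X) * G"
  proof (rule fps_ext)
    show "\<sigma> G $ n = ((1 - fps_X) * G) $ n" for n
      using step by (cases n) (simp_all add: \<sigma> G_def left_diff_distrib qpoch_Suc field_simps)
  qed
  have \<sigma>\<sigma>G: "\<sigma> (\<sigma> G) = (1 - fps_const q * fps_X) * (1 - fps_X) * G"
    unfolding G \<sigma>_mult by (simp add: G \<sigma>_def fps_compose_sub_distrib mult.assoc)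
  have e: "(1 - q ^ Suc k) * (1 - \<gamma> * q ^ k) * e (Suc k) = - \<delta> * q ^ k * e k" for k
  proof -
    have "Suc k * (Suc k + 1) div 2 = k * (k + 1) div 2 + Suc k"
      by simp
    then have "e (Suc k) = e k * (q ^ Suc k * - (\<delta> / q) / ((1 - \<gamma> * q ^ k) * (1 - q * q ^ k)))"
      by (simp add: e_def power_add qpoch_Suc mult_ac)
    then show ?thesis
      using step[of k] assms(1) by simp
  qed
  \<comment> \<open>The left side multiplies the \<open>n\<close>-th coefficient by
    \<open>(1 - q ^ n) * (q - \<gamma> * q ^ n)\<close>. This is zero for \<open>n = 0\<close>, and
    for \<open>n = Suc k\<close> it is \<open>q\<close> times the factor in
    \<open>e\<close>.\<close>
  have E: "fps_const q * E - fps_const (q + \<gamma>) * \<sigma> E + fps_const \<gamma> * \<sigma> (\<sigma> E)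
      = - (fps_const (\<delta> * q) * fps_X * \<sigma> E)"
  proof (rule fps_ext)
    fix n
    show "(fps_const q * E - fps_const (q + \<gamma>) * \<sigma> E + fps_const \<gamma> * \<sigma> (\<sigma> E)) $ n
        = (- (fps_const (\<delta> * q) * fps_X * \<sigma> E)) $ n"
    proof (cases n)
      case (Suc k)
      then show ?thesis
        using arg_cong[OF e[of k], of "\<lambda>z. q * z"]
        by (simp add: \<sigma> E_def mult.assoc) (simp add: algebra_simps)
    qed (simp add: \<sigma> algebra_simps)
  qed
  \<comment> \<open>\<open>\<sigma> G\<close> and \<open>\<sigma> (\<sigma> G)\<close> bring factors
    \<open>1 - w\<close> and \<open>(1 - w) * (1 - q * w)\<close>. Multiplying each term by what it
    still lacks makes \<open>?F\<close> a common factor and leaves the equation of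
    \<open>E\<close>.\<close>
  let ?F = "(1 - fps_X) * (1 - fps_const q * fps_X) * G"
  have "fps_const q * (1 - fps_X) * (1 - fps_const q * fps_X) * (E * G)
      - (fps_const (q + \<gamma>) - fps_const (\<delta> * q) * fps_X) * (1 - fps_const q * fps_X) * \<sigma> (E * G)
      + fps_const \<gamma> * \<sigma> (\<sigma> (E * G))
      = (fps_const q * E - fps_const (q + \<gamma>) * \<sigma> E + fps_const \<gamma> * \<sigma> (\<sigma> E)
          + fps_const (\<delta> * q) * fps_X * \<sigma> E) * ?F"
    unfolding \<sigma>_mult unfolding \<sigma>\<sigma>G unfolding G by (simp add: algebra_simps)
  also have "\<dots> = 0"
    unfolding E by simp
  finally have eq: "fps_const q * (E * G) - fps_const (q * (1 + q)) * (fps_X * (E * G))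
      + fps_const (q * q) * (fps_X * (fps_X * (E * G)))
      - fps_const (q + \<gamma>) * \<sigma> (E * G)
      + fps_const (\<delta> * q + q * (q + \<gamma>)) * (fps_X * \<sigma> (E * G))
      - fps_const (\<delta> * q * q) * (fps_X * (fps_X * \<sigma> (E * G)))
      + fps_const \<gamma> * \<sigma> (\<sigma> (E * G)) = 0"
    by (simp add: algebra_simps flip: fps_const_add fps_const_mult)
  define P where "P = E * G"
  note eqP = eq[folded P_def]
  have P: "S n = P $ n" for n
    by (simp add: S P_def)
  have P0: "P $ 0 = 1"
    by (simp add: P_def E_def e_def G_def)
  have "q * ((1 - q) * (1 - \<gamma>) * S 1) - q * (1 - \<gamma> - \<delta>) = 0"
    using arg_cong[OF eqP, of "\<lambda>F. F $ 1"] by (simp add: P P0 \<sigma>) algebra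
  then show "(1 - q) * (1 - \<gamma>) * S 1 = 1 - \<gamma> - \<delta>"
    using assms(1) by simp
  have "q * P $ (n + 2) - q * (1 + q) * P $ (n + 1) + q * q * P $ n
      - (q + \<gamma>) * (q ^ (n + 2) * P $ (n + 2))
      + (\<delta> * q + q * (q + \<gamma>)) * (q ^ (n + 1) * P $ (n + 1))
      - \<delta> * q * q * (q ^ n * P $ n) + \<gamma> * (q ^ (n + 2) * (q ^ (n + 2) * P $ (n + 2))) = 0"
    using arg_cong[OF eqP, of "\<lambda>F. F $ (n + 2)"] by (simp add: \<sigma> eval_nat_numeral)
  also have "q * P $ (n + 2) - q * (1 + q) * P $ (n + 1) + q * q * P $ n
      - (q + \<gamma>) * (q ^ (n + 2) * P $ (n + 2))
      + (\<delta> * q + q * (q + \<gamma>)) * (q ^ (n + 1) * P $ (n + 1))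
      - \<delta> * q * q * (q ^ n * P $ n) + \<gamma> * (q ^ (n + 2) * (q ^ (n + 2) * P $ (n + 2)))
    = q * ((1 - q ^ (n + 2)) * (1 - \<gamma> * q ^ (n + 1)) * S (n + 2)
      - ((1 + q - (\<delta> + q + \<gamma>) * q ^ (n + 1)) * S (n + 1) - q * (1 - \<delta> * q ^ n) * S n))"
    by (simp add: P algebra_simps)
  finally have "(1 - q ^ (n + 2)) * (1 - \<gamma> * q ^ (n + 1)) * S (n + 2)
      - ((1 + q - (\<delta> + q + \<gamma>) * q ^ (n + 1)) * S (n + 1) - q * (1 - \<delta> * q ^ n) * S n) = 0"
    using assms(1) by simp
  then show "(1 - q ^ (n + 2)) * (1 - \<gamma> * q ^ (n + 1)) * S (n + 2)
      = (1 + q - (\<delta> + q + \<gamma>) * q ^ (n + 1)) * S (n + 1) - q * (1 - \<delta> * q ^ n) * S n"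
    by simp
qed

section \<open>The equation with rational coefficients\<close>

definition reduced_lhs ::
    "complex \<Rightarrow> complex \<Rightarrow> complex \<Rightarrow> complex \<Rightarrow> complex \<Rightarrow> complex
     \<Rightarrow> complex \<Rightarrow> complex \<Rightarrow> complex \<Rightarrow> complex \<Rightarrow> complex" where
  "reduced_lhs q A B C L M x gq gp g0 =
     (x - A) * (x - B) * gq - L\<^sup>2 * q * A * B / C * (x - C) * gp
     - (M * x\<^sup>2 - L * (A + B + q * A * B / C) * x + L * (q + 1) * A * B) * g0"

lemma reduced_lhs_commute: "reduced_lhs q A B C = reduced_lhs q B A C"
  by (simp add: reduced_lhs_def fun_eq_iff mult_ac add_ac)

text \<open>With \<open>r\<close> a square root of \<open>q\<close>, half-integral powers become
  powers of \<open>r\<close> and an identity of rational functions remains. In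
  \<open>A * B / C\<close> the nonzero \<open>t 1\<close> cancels.\<close>

lemma confluent_lhs_eq_reduced:
  assumes "exp lq = q" "t 1 \<noteq> 0"
  shows "confluent_lhs q lq h1 l \<alpha>1 lam t =
    reduced_lhs q (qpow lq (l 1 - 1/2) * t 1) (qpow lq (l 2 - 1/2) * t 2)
      (qpow lq (h1 + 1/2) * t 1) (qpow lq lam) (qpow lq (- \<alpha>1))"
proof -
  define r where "r = qpow lq (1/2)"
  have r: "q = r * r" "r \<noteq> 0"
    using assms qpow_half[of lq] by (auto simp: r_def)
  show ?thesis
    unfolding confluent_lhs_def reduced_lhs_def fun_eq_iff qpow_add qpow_diff qpow_minus
      qpow_double r_def[symmetric]
    using assms(2) r(2) by (simp add: r(1) divide_simps) (simp add: algebra_simps power2_eq_square)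
qed

section \<open>The three series as solutions of the rational equation\<close>

text \<open>In \<open>y = x / A\<close> the factor \<open>x - A\<close> is
  \<open>- A * (1 - y)\<close>, which turns \<open>\<phi> n (q * x)\<close> into
  \<open>\<phi> (n + 1) x\<close>; the other terms are handled by \<open>qpoch_expansions\<close>.
  The parameter \<open>a\<close> stands for q^(lambda + alpha1), so \<open>L / a\<close> is
  q^(-alpha1).\<close>

lemma reduced_lhs_solution_poly:
  fixes q A B C L a :: complex
  assumes q: "q \<noteq> 0" "\<And>n. qpoch q q n \<noteq> 0"
    and nz: "A \<noteq> 0" "B \<noteq> 0" "C \<noteq> 0" "L \<noteq> 0" "a \<noteq> 0"
    and den: "\<And>n. qpoch (C / A) q n \<noteq> 0"
  defines "s \<equiv> \<lambda>n. (C / (a * B)) ^ n * (qpoch a q n / (qpoch (C / A) q n * qpoch q q n))"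
  defines "\<phi> \<equiv> \<lambda>n x. qpoch (x / A) q n"
  shows "coefficients_cancel \<phi> (\<lambda>n x. reduced_lhs q A B C L (L / a) x
    (L * (s n * \<phi> n (q * x))) (inverse L * (s n * \<phi> n (x / q))) (s n * \<phi> n x))"
proof (rule coefficients_cancel_banded)
  let ?e0 = "\<lambda>n. let p = 1 / q ^ n in
    L * s n * ((1 - p) * (- (q * A * B / C)) * (A * q * p - C))"
  let ?e1 = "\<lambda>n. let p = 1 / q ^ n in
    L * s n * (- (q * A * B / C) * (p * (A * p - C) - (1 - p) * A * q * p)
      - (A\<^sup>2 * p\<^sup>2 / a - (A + B + q * A * B / C) * A * p + (q + 1) * A * B))"
  let ?e2 = "\<lambda>n. let p = 1 / q ^ n in
    L * s n * (A * B - A\<^sup>2 * p / q + q * A * B / C * A * p\<^sup>2 + A\<^sup>2 * p\<^sup>2 / a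
      + A\<^sup>2 * p\<^sup>2 / (q * a) - (A + B + q * A * B / C) * A * p)"
  let ?e3 = "\<lambda>n. let p = 1 / q ^ n in L * s n * (A\<^sup>2 * p / q - A\<^sup>2 * p\<^sup>2 / (q * a))"
  show "reduced_lhs q A B C L (L / a) x
      (L * (s n * \<phi> n (q * x))) (inverse L * (s n * \<phi> n (x / q))) (s n * \<phi> n x)
    = ?e0 n * \<phi> (n - 1) x + ?e1 n * \<phi> n x + ?e2 n * \<phi> (n + 1) x + ?e3 n * \<phi> (n + 2) x"
    for n x
  proof -
    define y where "y = x / A"
    define p where "p = 1 / q ^ n"
    define f where "f m = qpoch y q m" for m
    define D where "D = (1 - p) * f (n - 1)"
    have x: "x = A * y"
      using nz by (simp add: y_def)
    have phi: "\<phi> m x = f m" for m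
      by (simp add: \<phi>_def f_def y_def)
    have up: "\<phi> n (q * x) * (1 - y) = f (n + 1)"
      using qpoch_scaled_arg[of q y n] by (simp add: \<phi>_def f_def y_def)
    have "x / q / A = y / q"
      by (simp add: y_def)
    then have down: "\<phi> n (x / q) = p * f n + D"
      using qpoch_expansions(1)[OF q(1), of y n] by (simp add: \<phi>_def f_def p_def D_def)
    note exps = qpoch_expansions(2-)[OF q(1), of y n, folded p_def f_def, folded D_def]
    have "reduced_lhs q A B C L (L / a) (A * y) (L * (\<sigma> * F)) (inverse L * (\<sigma> * G)) (\<sigma> * h)
      = L * \<sigma> * (A * (B - A * y) * (F * (1 - y)) - q * A * B / C * (A * y - C) * G
          - (A\<^sup>2 / a * (y * (y * h)) - (A + B + q * A * B / C) * A * (y * h)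
             + (q + 1) * A * B * h))" for F G h \<sigma>
      using nz unfolding reduced_lhs_def
      by (simp add: divide_simps) (simp add: algebra_simps power2_eq_square)
    then have "reduced_lhs q A B C L (L / a) x
      (L * (s n * \<phi> n (q * x))) (inverse L * (s n * \<phi> n (x / q))) (s n * \<phi> n x)
      = L * s n * (A * (B - A * y) * (\<phi> n (q * x) * (1 - y))
          - q * A * B / C * (A * y - C) * \<phi> n (x / q)
          - (A\<^sup>2 / a * (y * (y * f n)) - (A + B + q * A * B / C) * A * (y * f n)
             + (q + 1) * A * B * f n))"
      unfolding phi x[symmetric] .
    also have "\<dots> = L * s n * (A * B * f (n + 1) - A\<^sup>2 * (y * f (n + 1))
          - q * A * B / C * (A * p * (y * f n) + A * (y * D) - C * p * f n - C * D)
          - (A\<^sup>2 / a * (y * (y * f n)) - (A + B + q * A * B / C) * A * (y * f n)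
             + (q + 1) * A * B * f n))"
      unfolding up down using nz by (simp add: field_simps power2_eq_square)
    \<comment> \<open>Only the inner product is expanded first, so that the second \<open>y\<close>
      meets \<open>f n\<close> and \<open>f (n + 1)\<close>, for which there are rules.\<close>
    also have "y * (y * f n) = p * (p * (f n - f (n + 1)) - p / q * (f (n + 1) - f (n + 2)))"
    proof -
      have "y * (y * f n) = p * (y * f n - y * f (n + 1))"
        by (subst exps(1)) (simp add: algebra_simps)
      then show ?thesis
        by (simp only: exps)
    qed
    also have "L * s n * (A * B * f (n + 1) - A\<^sup>2 * (y * f (n + 1))
          - q * A * B / C * (A * p * (y * f n) + A * (y * D) - C * p * f n - C * D)
          - (A\<^sup>2 / a * (p * (p * (f n - f (n + 1)) - p / q * (f (n + 1) - f (n + 2))))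
             - (A + B + q * A * B / C) * A * (y * f n) + (q + 1) * A * B * f n))
      = ?e0 n * \<phi> (n - 1) x + ?e1 n * \<phi> n x + ?e2 n * \<phi> (n + 1) x + ?e3 n * \<phi> (n + 2) x"
      unfolding phi exps Let_def p_def[symmetric] unfolding D_def
      by (simp add: ring_distribs power2_eq_square diff_divide_distrib add_divide_distrib mult_ac)
    finally show ?thesis .
  qed
  \<comment> \<open>\<open>r n\<close> is the residual of the first-order recurrence of the
    hypergeometric coefficients, cleared of denominators.\<close>
  define r where
    "r n = s (Suc n) * (A - C * q ^ n) * (1 - q ^ Suc n) * a * B - A * C * (1 - a * q ^ n) * s n" for n
  have r: "r n = 0" for n
  proof -
    define u v where "u = 1 - C / A * q ^ n" and "v = 1 - q ^ Suc n"
    have uv: "u \<noteq> 0" "v \<noteq> 0"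
      using den[of "Suc n"] q(2)[of "Suc n"] by (auto simp: qpoch_Suc u_def v_def)
    have "s (Suc n) = s n * (C / (a * B) * (1 - a * q ^ n) / (u * v))"
      by (simp add: s_def qpoch_Suc u_def v_def mult_ac)
    moreover have "A - C * q ^ n = A * u"
      using nz by (simp add: u_def algebra_simps)
    ultimately show ?thesis
      using nz uv unfolding r_def v_def[symmetric] by simp
  qed
  show "?e0 0 = 0"
    by simp
  \<comment> \<open>Columns 0 and 1 follow the pattern of the general column below, with
    \<open>r\<close> read as zero at negative indices.\<close>
  have "?e0 1 + ?e1 0 = L * (A / (C * a)) * r 0"
    using nz q(1) unfolding r_def Let_def
    by (simp add: divide_simps) (simp add: algebra_simps power2_eq_square)
  then show "?e0 1 + ?e1 0 = 0"
    by (simp add: r)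
  have "?e0 2 + ?e1 1 + ?e2 0 = L * (A / (C * a * q\<^sup>2)) * (r 1 - (q + q\<^sup>2) * r 0)"
    using nz q(1) unfolding r_def Let_def
    by (simp add: divide_simps numeral_2_eq_2) (simp add: algebra_simps)
  then show "?e0 2 + ?e1 1 + ?e2 0 = 0"
    by (simp add: r)
  show "?e0 (k + 3) + ?e1 (k + 2) + ?e2 (k + 1) + ?e3 k = 0" for k
  proof -
    define Q where "Q = q ^ k"
    have Q: "Q \<noteq> 0"
      using q(1) by (simp add: Q_def)
    have pows: "q ^ k = Q" "q ^ (k + 1) = Q * q" "q ^ (k + 2) = Q * q * q" "q ^ (k + 3) = Q * q * q * q"
      "q ^ Suc (k + 1) = Q * q * q" "q ^ Suc (k + 2) = Q * q * q * q" "q ^ Suc k = Q * q"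
      by (simp_all add: Q_def power_add eval_nat_numeral)
    have sucs: "s (Suc (k + 2)) = s (k + 3)" "s (Suc (k + 1)) = s (k + 2)" "s (Suc k) = s (k + 1)"
      by (simp_all add: eval_nat_numeral)
    \<comment> \<open>With \<open>T\<close> the index shift, the bracket is
      \<open>(T - q) * (T - q\<^sup>2)\<close> applied to \<open>r\<close>.\<close>
    have "?e0 (k + 3) + ?e1 (k + 2) + ?e2 (k + 1) + ?e3 k
      = L * (A / (C * a * q ^ 4 * Q\<^sup>2)) * (r (k + 2) - (q + q\<^sup>2) * r (k + 1) + q ^ 3 * r k)"
      using nz q(1) Q unfolding r_def Let_def pows sucs
      by (simp add: divide_simps eval_nat_numeral) (simp add: algebra_simps)
    then show ?thesis
      by (simp add: r)
  qed
qed

text \<open>The equation sends the power \<open>n\<close> of \<open>1 / x\<close> only to the powers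
  \<open>n\<close>, \<open>n + 1\<close>, \<open>n + 2\<close>. The last two coefficients contain
  \<open>1 - a * q ^ n\<close> and \<open>(1 - a * q ^ n) * (1 - a * q ^ (n + 1))\<close>, which
  match the growth of \<open>qpoch a q n\<close>; once these are split off, the recurrence of the
  inner sum remains.\<close>

lemma reduced_lhs_solution_infinity:
  fixes q r A B C M a :: complex
  assumes q: "q \<noteq> 0" "\<And>n. qpoch q q n \<noteq> 0" and r: "r * r = q"
    and nz: "C \<noteq> 0" "M \<noteq> 0" "a \<noteq> 0"
  defines "s \<equiv> \<lambda>n. r ^ n * qpoch a q n
    * (\<Sum>k\<le>n. qpoch (a * q * A / C) q (n - k) / (qpoch q q k * qpoch q q (n - k))
         * (r * A) ^ k * (r * B) ^ (n - k))"
  defines "\<phi> \<equiv> \<lambda>n x. (1 / x) ^ n"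
  shows "coefficients_cancel \<phi> (\<lambda>n x. reduced_lhs q A B C (a * M) M x
    (M * (s n * \<phi> n (q * x))) (inverse M * (s n * \<phi> n (x / q))) (s n * \<phi> n x) / x\<^sup>2)"
proof (rule coefficients_cancel_banded)
  define c where "c n = (\<Sum>k\<le>n. qpoch (a * q * A / C) q (n - k) / (qpoch q q k * qpoch q q (n - k))
    * (r * A) ^ k * (r * B) ^ (n - k))" for n
  have s: "s n = r ^ n * qpoch a q n * c n" for n
    by (simp add: s_def c_def)
  let ?e1 = "\<lambda>n. M * s n * (1 / q ^ n - 1)"
  let ?e2 = "\<lambda>n. M * s n * (- (A + B) / q ^ n - a\<^sup>2 * q * A * B / C * q ^ n
    + a * (A + B + q * A * B / C))"
  let ?e3 = "\<lambda>n. M * s n * (A * B / q ^ n + a\<^sup>2 * q * A * B * q ^ n - a * (q + 1) * A * B)"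
  show "reduced_lhs q A B C (a * M) M x
      (M * (s n * \<phi> n (q * x))) (inverse M * (s n * \<phi> n (x / q))) (s n * \<phi> n x) / x\<^sup>2
    = 0 * \<phi> (n - 1) x + ?e1 n * \<phi> n x + ?e2 n * \<phi> (n + 1) x + ?e3 n * \<phi> (n + 2) x"
    if "x \<noteq> 0" for n x
  proof -
    define f where "f = \<phi> n x"
    have "\<phi> n (q * x) = f / q ^ n" "\<phi> n (x / q) = f * q ^ n"
      "\<phi> (n + 1) x = f / x" "\<phi> (n + 2) x = f / x\<^sup>2"
      by (simp_all add: \<phi>_def f_def power_divide power_mult_distrib power2_eq_square)
    then show ?thesis
      using nz q(1) that unfolding reduced_lhs_def f_def[symmetric]
      by (simp add: divide_simps) (simp add: algebra_simps power2_eq_square)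
  qed
  \<comment> \<open>The band \<open>e0\<close> is identically zero here, so this is the hypothesis
    on \<open>e0 0\<close>.\<close>
  show "(0::complex) = 0" ..
  note rec = qbinomial_convolution_recurrence[OF q(2), where s = "a * q * A / C" and \<alpha> = "r * A" and \<beta> = "r * B",
      folded c_def]
  have c0: "c 0 = 1"
    by (simp add: c_def)
  \<comment> \<open>The leading terms cancel because the exponent of the series is -alpha1.\<close>
  show "0 + ?e1 0 = 0"
    by simp
  have "0 + ?e1 1 + ?e2 0 = M * (1 - a) * r / q
      * ((1 - q) * c 1 - (r * A + r * B - a * q * A / C * (r * B)))"
    using nz q(1) c0 unfolding s r[symmetric]
    by (simp add: divide_simps qpoch_Suc) (simp add: algebra_simps power2_eq_square)
  then show "0 + ?e1 1 + ?e2 0 = 0"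
    using rec(1) by simp
  show "0 + ?e1 (k + 2) + ?e2 (k + 1) + ?e3 k = 0" for k
  proof -
    define Q where "Q = q ^ k"
    have Q: "Q \<noteq> 0"
      using q(1) by (simp add: Q_def)
    have pows: "q ^ k = Q" "q ^ (k + 1) = Q * q" "q ^ (k + 2) = Q * q * q"
      by (simp_all add: Q_def power_add eval_nat_numeral)
    have s': "s (k + 2) = r ^ k * q * qpoch a q k * (1 - a * Q) * (1 - a * Q * q) * c (k + 2)"
      "s (k + 1) = r ^ k * r * qpoch a q k * (1 - a * Q) * c (k + 1)"
      "s k = r ^ k * qpoch a q k * c k"
      using r by (simp_all add: s qpoch_Suc Q_def eval_nat_numeral mult_ac)
    have "0 + ?e1 (k + 2) + ?e2 (k + 1) + ?e3 k
      = M * r ^ k * qpoch a q k * (1 - a * Q) * (1 - a * Q * q) / (Q * q)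
        * ((1 - q ^ (k + 2)) * c (k + 2)
           - ((r * A + r * B - a * q * A / C * (r * B) * q ^ (k + 1)) * c (k + 1)
              - r * A * (r * B) * c k))"
      using nz q(1) Q unfolding s' pows unfolding r[symmetric]
      by (simp add: divide_simps) (simp add: algebra_simps power2_eq_square)
    then show ?thesis
      unfolding rec(2) by simp
  qed
qed

text \<open>In \<open>y = C / x\<close> the two shifts exchange roles: \<open>x - C\<close> now
  supplies the factor \<open>1 - y\<close> that turns \<open>\<phi> n (x / q)\<close> into
  \<open>\<phi> (n + 1) x\<close>. Writing the zeros as \<open>C / \<gamma>\<close> and
  \<open>C / \<delta>\<close> makes the coefficient of the other shift a multiple of
  \<open>(\<gamma> - y) * (\<delta> - y)\<close>.\<close>

lemma reduced_lhs_solution_inverse: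
  fixes q \<gamma> \<delta> C M a :: complex
  assumes q: "q \<noteq> 0" "\<And>n. qpoch q q n \<noteq> 0"
    and nz: "\<gamma> \<noteq> 0" "\<delta> \<noteq> 0" "C \<noteq> 0" "M \<noteq> 0"
    and den: "\<And>n. qpoch \<gamma> q n \<noteq> 0" "\<And>n. qpoch \<delta> q n \<noteq> 0"
  defines "s \<equiv> \<lambda>n. qpoch a q n / qpoch \<delta> q n * q ^ n
    * (\<Sum>k\<le>n. q ^ (k * (k + 1) div 2) * (- (\<delta> / q)) ^ k
         / (qpoch \<gamma> q k * qpoch q q k * qpoch q q (n - k)))"
  defines "\<phi> \<equiv> \<lambda>n x. qpoch (C / x) q n"
  shows "coefficients_cancel \<phi> (\<lambda>n x. reduced_lhs q (C / \<gamma>) (C / \<delta>) C (a * M) M x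
    (M * (s n * \<phi> n (q * x))) (inverse M * (s n * \<phi> n (x / q))) (s n * \<phi> n x) / x\<^sup>2)"
proof (rule coefficients_cancel_banded)
  define S where "S n = (\<Sum>k\<le>n. q ^ (k * (k + 1) div 2) * (- (\<delta> / q)) ^ k
         / (qpoch \<gamma> q k * qpoch q q k * qpoch q q (n - k)))" for n
  have s: "s n = qpoch a q n / qpoch \<delta> q n * q ^ n * S n" for n
    by (simp add: s_def S_def)
  define N where "N = M / (\<gamma> * \<delta>)"
  let ?e0 = "\<lambda>n. let p = 1 / q ^ n in N * s n * ((1 - p) * (\<gamma> - q * p) * (\<delta> - q * p))"
  let ?e1 = "\<lambda>n. let p = 1 / q ^ n in
    N * s n * (\<gamma> * \<delta> * p - (\<gamma> + \<delta>) * (p\<^sup>2 - q * p * (1 - p))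
      + (p ^ 3 - q\<^sup>2 * p\<^sup>2 * (1 - p) - q * p\<^sup>2 * (1 - p))
      - \<gamma> * \<delta> + a * (\<gamma> + \<delta> + q) * p - a * (q + 1) * p\<^sup>2)"
  let ?e2 = "\<lambda>n. let p = 1 / q ^ n in
    N * s n * ((\<gamma> + \<delta>) * p\<^sup>2 - p ^ 3 - p ^ 3 / q + q * p\<^sup>2 * (1 - p)
      - a\<^sup>2 * p - a * (\<gamma> + \<delta> + q) * p + a * (q + 1) * (p\<^sup>2 + p\<^sup>2 / q))"
  let ?e3 = "\<lambda>n. let p = 1 / q ^ n in
    N * s n * (p ^ 3 / q + a\<^sup>2 * p - a * (q + 1) * p\<^sup>2 / q)"
  show "reduced_lhs q (C / \<gamma>) (C / \<delta>) C (a * M) M x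
      (M * (s n * \<phi> n (q * x))) (inverse M * (s n * \<phi> n (x / q))) (s n * \<phi> n x) / x\<^sup>2
    = ?e0 n * \<phi> (n - 1) x + ?e1 n * \<phi> n x + ?e2 n * \<phi> (n + 1) x + ?e3 n * \<phi> (n + 2) x"
    if "x \<noteq> 0" for n x
  proof -
    define y where "y = C / x"
    define p where "p = 1 / q ^ n"
    define f where "f m = qpoch y q m" for m
    define D where "D = (1 - p) * f (n - 1)"
    have x: "x = C / y" and y: "y \<noteq> 0"
      using nz that by (simp_all add: y_def)
    have phi: "\<phi> m x = f m" for m
      by (simp add: \<phi>_def f_def y_def)
    have "C / (x / q) = q * y" "C / (q * x) = y / q"
      by (simp_all add: y_def)
    then have down: "\<phi> n (x / q) * (1 - y) = f (n + 1)" and up: "\<phi> n (q * x) = p * f n + D"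
      using qpoch_scaled_arg[of q y n] qpoch_expansions(1)[OF q(1), of y n]
      by (simp_all add: \<phi>_def f_def p_def D_def)
    note exps = qpoch_expansions(2-)[OF q(1), of y n, folded p_def f_def, folded D_def]
    have "reduced_lhs q (C / \<gamma>) (C / \<delta>) C (a * M) M (C / y)
        (M * (\<sigma> * F)) (inverse M * (\<sigma> * G)) (\<sigma> * h) / (C / y)\<^sup>2
      = N * \<sigma> * ((\<gamma> - y) * (\<delta> - y) * F - a\<^sup>2 * q * y * (G * (1 - y))
          - (\<gamma> * \<delta> * h - a * (\<gamma> + \<delta> + q) * (y * h) + a * (q + 1) * (y * (y * h))))"
      for F G h \<sigma>
      using nz y unfolding reduced_lhs_def N_def
      by (simp add: divide_simps) (simp add: algebra_simps power2_eq_square)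
    then have "reduced_lhs q (C / \<gamma>) (C / \<delta>) C (a * M) M x
      (M * (s n * \<phi> n (q * x))) (inverse M * (s n * \<phi> n (x / q))) (s n * \<phi> n x) / x\<^sup>2
      = N * s n * ((\<gamma> - y) * (\<delta> - y) * \<phi> n (q * x) - a\<^sup>2 * q * y * (\<phi> n (x / q) * (1 - y))
          - (\<gamma> * \<delta> * f n - a * (\<gamma> + \<delta> + q) * (y * f n) + a * (q + 1) * (y * (y * f n))))"
      unfolding phi x[symmetric] .
    also have "\<dots> = N * s n * (\<gamma> * \<delta> * (p * f n + D)
          - (\<gamma> + \<delta>) * (p * (y * f n) + y * D) + (p * (y * (y * f n)) + y * (y * D))
          - a\<^sup>2 * q * (y * f (n + 1))
          - (\<gamma> * \<delta> * f n - a * (\<gamma> + \<delta> + q) * (y * f n) + a * (q + 1) * (y * (y * f n))))"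
      unfolding up down by (simp add: algebra_simps)
    also have "y * (y * f n) = p * (p * (f n - f (n + 1)) - p / q * (f (n + 1) - f (n + 2)))"
    proof -
      have "y * (y * f n) = p * (y * f n - y * f (n + 1))"
        by (subst exps(1)) (simp add: algebra_simps)
      then show ?thesis
        by (simp only: exps)
    qed
    also have "y * (y * D) = q * p * (q * p * (D - (1 - p) * f n) - (1 - p) * (p * (f n - f (n + 1))))"
    proof -
      have "y * (y * D) = q * p * (y * D - (1 - p) * (y * f n))"
        by (subst exps(3)) (simp add: algebra_simps)
      then show ?thesis
        by (simp only: exps)
    qed
    also have "N * s n * (\<gamma> * \<delta> * (p * f n + D)
          - (\<gamma> + \<delta>) * (p * (y * f n) + y * D)
          + (p * (p * (p * (f n - f (n + 1)) - p / q * (f (n + 1) - f (n + 2))))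
             + q * p * (q * p * (D - (1 - p) * f n) - (1 - p) * (p * (f n - f (n + 1)))))
          - a\<^sup>2 * q * (y * f (n + 1))
          - (\<gamma> * \<delta> * f n - a * (\<gamma> + \<delta> + q) * (y * f n)
             + a * (q + 1) * (p * (p * (f n - f (n + 1)) - p / q * (f (n + 1) - f (n + 2))))))
      = ?e0 n * \<phi> (n - 1) x + ?e1 n * \<phi> n x + ?e2 n * \<phi> (n + 1) x + ?e3 n * \<phi> (n + 2) x"
      unfolding phi exps Let_def p_def[symmetric] unfolding D_def using q(1)
      by (simp add: divide_simps) (simp add: algebra_simps eval_nat_numeral)
    finally show ?thesis .
  qed
  note rec = qexp_convolution_recurrence[OF q den(1), where \<delta> = \<delta>, folded S_def]
  have S0: "S 0 = 1"
    by (simp add: S_def)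
  have den': "1 - \<delta> * q ^ n \<noteq> 0" for n
    using den(2)[of "Suc n"] by (simp add: qpoch_Suc)
  show "?e0 0 = 0"
    by simp
  \<comment> \<open>The last bracket is the three-term recurrence at index -1, with \<open>S\<close>
    read as zero there.\<close>
  have "?e0 1 + ?e1 0 = - N * (1 - a) * ((1 - q) * (1 - \<gamma>) * S 1 - (1 - \<gamma> - \<delta>))"
    using q(1) den'[of 0] unfolding s Let_def
    by (simp add: divide_simps qpoch_Suc S0) (simp add: algebra_simps power2_eq_square)
  then show "?e0 1 + ?e1 0 = 0"
    using rec(1) by simp
  have "1 - \<delta> \<noteq> 0" "1 - \<delta> * q \<noteq> 0"
    using den'[of 0] den'[of 1] by simp_all
  then have s2: "s 2 = (1 - a) * (1 - a * q) / ((1 - \<delta>) * (1 - \<delta> * q)) * q\<^sup>2 * S 2"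
    and s1: "s 1 = (1 - a) / (1 - \<delta>) * q * S 1" and s0: "s 0 = 1"
    by (simp_all add: s qpoch_Suc S0 numeral_2_eq_2)
  \<comment> \<open>The factor \<open>\<delta> - q * p\<close> of \<open>?e0\<close> cancels the
    last factor of \<open>qpoch \<delta> q 2\<close>, so only \<open>1 - \<delta>\<close> is left as
    a denominator.\<close>
  have e0: "?e0 2 = - (N * (1 - a) * (1 - a * q) / (1 - \<delta>) * q * S 2
      * ((1 - 1 / q\<^sup>2) * (\<gamma> - 1 / q)))"
    using \<open>1 - \<delta> \<noteq> 0\<close> \<open>1 - \<delta> * q \<noteq> 0\<close> q(1) unfolding s2 Let_def
    by (simp add: divide_simps) (simp add: algebra_simps eval_nat_numeral)
  have "?e0 2 + ?e1 1 + ?e2 0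
    = N * (1 - a) / (q\<^sup>2 * (1 - \<delta>))
      * (q\<^sup>2 * (1 - \<delta>) * ((1 - q) * (1 - \<gamma>) * S 1 - (1 - \<gamma> - \<delta>))
         - (1 - a * q) * ((1 - q ^ (0 + 2)) * (1 - \<gamma> * q ^ (0 + 1)) * S (0 + 2)
        - ((1 + q - (\<delta> + q + \<gamma>) * q ^ (0 + 1)) * S (0 + 1) - q * (1 - \<delta> * q ^ 0) * S 0)))"
    using q(1) \<open>1 - \<delta> \<noteq> 0\<close> unfolding e0 unfolding s1 s0 Let_def
    by (simp add: divide_simps S0) (simp add: algebra_simps eval_nat_numeral)
  then show "?e0 2 + ?e1 1 + ?e2 0 = 0"
    unfolding rec by simp
  show "?e0 (k + 3) + ?e1 (k + 2) + ?e2 (k + 1) + ?e3 k = 0" for k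
  proof -
    define Q where "Q = q ^ k"
    \<comment> \<open>This is \<open>qpoch a q k / qpoch \<delta> q (k + 2)\<close>. The one further
      denominator, in \<open>s (k + 3)\<close>, is cancelled by \<open>?e0\<close>.\<close>
    define v where "v = qpoch a q k / (qpoch \<delta> q k * (1 - \<delta> * Q) * (1 - \<delta> * Q * q))"
    have Q: "Q \<noteq> 0" and den'': "1 - \<delta> * Q \<noteq> 0" "1 - \<delta> * Q * q \<noteq> 0" "1 - \<delta> * Q * q * q \<noteq> 0"
      using q(1) den'[of k] den'[of "k + 1"] den'[of "k + 2"] by (simp_all add: Q_def mult_ac)
    have pows: "q ^ k = Q" "q ^ (k + 1) = Q * q" "q ^ (k + 2) = Q * q * q"
      "q ^ (k + 3) = Q * q * q * q" "q ^ (k + 1 + 1) = Q * q * q" "q ^ (k + 1 + 2) = Q * q * q * q"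
      by (simp_all add: Q_def power_add eval_nat_numeral)
    have s': "s (k + 3) = v * (1 - a * Q) * (1 - a * Q * q) * (1 - a * Q * q * q)
          / (1 - \<delta> * Q * q * q) * Q * q * q * q * S (k + 3)"
      "s (k + 2) = v * (1 - a * Q) * (1 - a * Q * q) * Q * q * q * S (k + 2)"
      "s (k + 1) = v * (1 - a * Q) * (1 - \<delta> * Q * q) * Q * q * S (k + 1)"
      "s k = v * (1 - \<delta> * Q) * (1 - \<delta> * Q * q) * Q * S k"
      using den'' den(2)[of k] by (simp_all add: s v_def qpoch_Suc Q_def eval_nat_numeral mult_ac)
    let ?R = "\<lambda>n. (1 - q ^ (n + 2)) * (1 - \<gamma> * q ^ (n + 1)) * S (n + 2)
      - ((1 + q - (\<delta> + q + \<gamma>) * q ^ (n + 1)) * S (n + 1) - q * (1 - \<delta> * q ^ n) * S n)"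
    have e0: "?e0 (k + 3) = - (N * v * (1 - a * Q) * (1 - a * Q * q) * (1 - a * Q * q * q)
        * S (k + 3) * ((1 - 1 / (Q * q * q * q)) * (\<gamma> - 1 / (Q * q * q))) * q)"
      using den'' q(1) Q unfolding s' pows Let_def
      by (simp add: divide_simps) (simp add: algebra_simps)
    have sucs: "S (k + 1 + 2) = S (k + 3)" "S (k + 1 + 1) = S (k + 2)"
      by (simp_all add: eval_nat_numeral)
    \<comment> \<open>\<open>?R\<close> is the residual of the three-term recurrence; the four-term
      condition combines two consecutive residuals.\<close>
    have "?e0 (k + 3) + ?e1 (k + 2) + ?e2 (k + 1) + ?e3 k
      = N * v * (1 - a * Q) * (1 - a * Q * q) / (Q * q * q)\<^sup>2
        * (q\<^sup>2 * (1 - \<delta> * Q * q) * ?R k - (1 - a * Q * q * q) * ?R (k + 1))"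
      using q(1) Q unfolding e0 unfolding s' pows sucs Let_def
      by (simp add: divide_simps) (simp add: algebra_simps eval_nat_numeral)
    then show ?thesis
      unfolding rec by simp
  qed
qed

section \<open>Return to the original parameters\<close>

theorem theorem5p1:
  fixes q lq h1 \<alpha>1 lam :: complex and l t :: "nat \<Rightarrow> complex"
  assumes "q \<noteq> 0" and "exp lq = q" and "\<forall>n::nat. n > 0 \<longrightarrow> q ^ n \<noteq> 1"
    and "t 1 \<noteq> 0" and "t 2 \<noteq> 0"
  shows
    "(\<forall>i i'. (i, i') \<in> {(1, 2), (2, 1)} \<longrightarrow>
        (\<forall>n. qpoch (qpow lq (h1 - l i + 1) * t 1 / t i) q n \<noteq> 0) \<longrightarrow>
        formal_solution q lq (confluent_lhs q lq h1 l \<alpha>1 lam t) lam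
          (\<lambda>n. (qpow lq (- lam - \<alpha>1 + h1 - l i' + 1) * t 1 / t i') ^ n
               * (qpoch (qpow lq (lam + \<alpha>1)) q n
                  / (qpoch (qpow lq (h1 - l i + 1) * t 1 / t i) q n * qpoch q q n)))
          (\<lambda>n x. qpoch (x / (qpow lq (l i - 1/2) * t i)) q n)
        \<and> (\<forall>n x.
             (qpow lq (- lam - \<alpha>1 + h1 - l i' + 1) * t 1 / t i') ^ n
             * (qpoch (qpow lq (lam + \<alpha>1)) q n
                / (qpoch (qpow lq (h1 - l i + 1) * t 1 / t i) q n * qpoch q q n))
             * qpoch (x / (qpow lq (l i - 1/2) * t i)) q n
           = bhs_term [qpow lq (lam + \<alpha>1), x / (qpow lq (l i - 1/2) * t i)]
               [qpow lq (h1 - l i + 1) * t 1 / t i] q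
               (qpow lq (- lam - \<alpha>1 + h1 - l i' + 1) * t 1 / t i') n))
     \<and> formal_solution_inv q lq (confluent_lhs q lq h1 l \<alpha>1 lam t) (- \<alpha>1)
          (\<lambda>n. qpow lq (1/2) ^ n * qpoch (qpow lq (lam + \<alpha>1)) q n
               * (\<Sum>k\<le>n. qpoch (qpow lq (lam + \<alpha>1 - h1 + l 1)) q (n - k)
                          / (qpoch q q k * qpoch q q (n - k))
                          * (qpow lq (l 1) * t 1) ^ k * (qpow lq (l 2) * t 2) ^ (n - k)))
          (\<lambda>n x. (1 / x) ^ n)
     \<and> ((\<forall>n. qpoch (qpow lq (h1 - l 2 + 1) * t 1 / t 2) q n \<noteq> 0) \<longrightarrow>
        (\<forall>n. qpoch (qpow lq (h1 - l 1 + 1)) q n \<noteq> 0) \<longrightarrow>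
        formal_solution_inv q lq (confluent_lhs q lq h1 l \<alpha>1 lam t) (- \<alpha>1)
          (\<lambda>n. qpoch (qpow lq (lam + \<alpha>1)) q n
               / qpoch (qpow lq (h1 - l 2 + 1) * t 1 / t 2) q n * q ^ n
               * (\<Sum>k\<le>n. q ^ (k * (k + 1) div 2) * (- qpow lq (h1 - l 2) * t 1 / t 2) ^ k
                          / (qpoch (qpow lq (h1 - l 1 + 1)) q k * qpoch q q k
                             * qpoch q q (n - k))))
          (\<lambda>n x. qpoch (qpow lq (h1 + 1/2) * t 1 / x) q n))"
proof -
  let ?q = "qpow lq" and ?E = "confluent_lhs q lq h1 l \<alpha>1 lam t"
  define A where "A i = ?q (l i - 1/2) * t i" for i
  define C where "C = ?q (h1 + 1/2) * t 1"
  define L where "L = ?q lam"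
  define M where "M = ?q (- \<alpha>1)"
  define a where "a = ?q (lam + \<alpha>1)"
  define r where "r = ?q (1/2)"
  have q: "q \<noteq> 0" "qpoch q q n \<noteq> 0" for n
  proof -
    have "1 - q * q ^ j \<noteq> 0" for j
      using assms(3)[rule_format, of "Suc j"] by simp
    then show "q \<noteq> 0" "qpoch q q n \<noteq> 0"
      using assms(1) by (simp_all add: qpoch_def)
  qed
  have r: "r * r = q" "r \<noteq> 0" and q1: "?q 1 = q"
    using assms(2) qpow_half[of lq] by (simp_all add: r_def qpow_def)
  have nz: "A 1 \<noteq> 0" "A 2 \<noteq> 0" "C \<noteq> 0" "L \<noteq> 0" "M \<noteq> 0" "a \<noteq> 0"
    using assms(4,5) by (simp_all add: A_def C_def L_def M_def a_def)
  have E: "?E = reduced_lhs q (A 1) (A 2) C L M"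
    using confluent_lhs_eq_reduced[of lq q t h1 l \<alpha>1 lam] assms(2,4) by (simp add: A_def C_def L_def M_def)
  have M: "M = L / a" and L: "L = a * M"
    by (simp_all add: M_def L_def a_def qpow_add qpow_minus divide_simps)
  have C_div: "?q (h1 - l i + 1) * t 1 / t i = C / A i" for i
    by (simp add: C_def A_def qpow_add qpow_diff q1 flip: r_def) (simp add: divide_simps flip: r(1))
  have z: "?q (- lam - \<alpha>1 + h1 - l i + 1) * t 1 / t i = C / (a * A i)" for i
    by (simp add: C_def A_def a_def qpow_add qpow_diff qpow_minus q1 flip: r_def)
      (simp add: divide_simps flip: r(1))
  have part1: "formal_solution q lq ?E lam
          (\<lambda>n. (?q (- lam - \<alpha>1 + h1 - l i' + 1) * t 1 / t i') ^ n
               * (qpoch (?q (lam + \<alpha>1)) q n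
                  / (qpoch (?q (h1 - l i + 1) * t 1 / t i) q n * qpoch q q n)))
          (\<lambda>n x. qpoch (x / (?q (l i - 1/2) * t i)) q n)"
    if "(i, i') \<in> {(1, 2), (2, 1)}"
      and den: "\<forall>n. qpoch (?q (h1 - l i + 1) * t 1 / t i) q n \<noteq> 0" for i i'
  proof -
    have Ai: "A i \<noteq> 0" "A i' \<noteq> 0"
      using that(1) nz by auto
    \<comment> \<open>The case \<open>i = 2\<close> uses the symmetry in the two zeros.\<close>
    have E': "?E = reduced_lhs q (A i) (A i') C L (L / a)"
      using that(1) E M reduced_lhs_commute[of q "A 2" "A 1"] by auto
    have "is_poly_of_degree n (\<lambda>x. qpoch (x / A i) q n)" for n
      using is_poly_of_degree_qpoch[of q "1 / A i" n] Ai q(1) by simp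
    then show ?thesis
      using reduced_lhs_solution_poly[OF q Ai nz(3,4,6) den[rule_format, unfolded C_div]]
      unfolding formal_solution_def subst_term_def z C_div E' qpow_minus
      by (simp flip: A_def a_def L_def)
  qed
  have part2: "formal_solution_inv q lq ?E (- \<alpha>1)
          (\<lambda>n. ?q (1/2) ^ n * qpoch (?q (lam + \<alpha>1)) q n
               * (\<Sum>k\<le>n. qpoch (?q (lam + \<alpha>1 - h1 + l 1)) q (n - k)
                          / (qpoch q q k * qpoch q q (n - k))
                          * (?q (l 1) * t 1) ^ k * (?q (l 2) * t 2) ^ (n - k)))
          (\<lambda>n x. (1 / x) ^ n)"
  proof -
    have s: "?q (lam + \<alpha>1 - h1 + l 1) = a * q * A 1 / C"
      using assms(4) r(2)
      by (simp add: C_def A_def a_def qpow_add qpow_diff flip: r_def) (simp flip: r(1))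
    have rA: "?q (l i) * t i = r * A i" for i
      using r(2) by (simp add: A_def qpow_diff flip: r_def)
    have "is_poly_of_degree n (\<lambda>y. y ^ n)" for n
      unfolding is_poly_of_degree_def
      by (intro exI[of _ "\<lambda>k. if k = n then 1 else 0"]) (simp add: if_distrib[of "\<lambda>c. c * _"] cong: if_cong)
    then show ?thesis
      using reduced_lhs_solution_infinity[OF q r(1) nz(3,5,6), of "A 1" "A 2"]
      \<comment> \<open>This instance of \<open>qpow_minus\<close> turns the factor of the backward
        shift into \<open>inverse M\<close> and leaves \<open>M\<close> itself alone.\<close>
      unfolding formal_solution_inv_def subst_term_def s rA E qpow_minus[of lq "- \<alpha>1"] L
      by (simp flip: r_def a_def M_def)
  qed
  have part3: "formal_solution_inv q lq ?E (- \<alpha>1)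
          (\<lambda>n. qpoch (?q (lam + \<alpha>1)) q n
               / qpoch (?q (h1 - l 2 + 1) * t 1 / t 2) q n * q ^ n
               * (\<Sum>k\<le>n. q ^ (k * (k + 1) div 2) * (- ?q (h1 - l 2) * t 1 / t 2) ^ k
                          / (qpoch (?q (h1 - l 1 + 1)) q k * qpoch q q k
                             * qpoch q q (n - k))))
          (\<lambda>n x. qpoch (?q (h1 + 1/2) * t 1 / x) q n)"
    if den: "\<forall>n. qpoch (?q (h1 - l 2 + 1) * t 1 / t 2) q n \<noteq> 0"
      "\<forall>n. qpoch (?q (h1 - l 1 + 1)) q n \<noteq> 0"
  proof -
    have \<gamma>: "?q (h1 - l 1 + 1) = C / A 1"
      using C_div[of 1] assms(4) by simp
    have \<delta>: "- ?q (h1 - l 2) * t 1 / t 2 = - (C / A 2 / q)"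
      using q(1) by (simp add: qpow_add q1 flip: C_div)
    have A: "C / (C / A i) = A i" for i
      using nz(3) by simp
    have nz': "C / A 1 \<noteq> 0" "C / A 2 \<noteq> 0"
      using nz by simp_all
    note sol = reduced_lhs_solution_inverse[OF q nz' nz(3,5) den(2)[rule_format, unfolded \<gamma>]
        den(1)[rule_format, unfolded C_div], of a, unfolded A, folded L]
    have "is_poly_of_degree n (\<lambda>y. qpoch (C / (1 / y)) q n)" for n
      using is_poly_of_degree_qpoch[of q C n] q(1) nz(3) by simp
    then show ?thesis
      using sol
      unfolding formal_solution_inv_def subst_term_def \<gamma> \<delta> C_div E qpow_minus[of lq "- \<alpha>1"]
        C_def[symmetric] a_def[symmetric] M_def[symmetric]
      by blast
  qed
  show ?thesis
    \<comment> \<open>For a 2phi1 the exponent of the sign and power factor in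
      \<open>bhs_term\<close> is \<open>1 + 1 - 2 = 0\<close>.\<close>
    using part1 part2 part3 by (intro conjI allI impI) (simp_all add: bhs_term_def)
qed

end
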